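(* Let $n,s$ be integers with $1\le s<n-1$, let $x\in\mathbb{R}^n$ and $\alpha=(\alpha_1,\dots,\alpha_s)\in\mathbb{R}^s$. Suppose that the polynomial $f(t)=t^s+\alpha_1t^{s-1}+\alpha_2t^{s-2}+\cdots+\alpha_s$ has only real roots. Then for every $k=1,\dots,n$, $$Q_{k;s}(x)^2-Q_{k-1;s}(x)\,Q_{k+1;s}(x)\ \ge\ \theta\,Q_{k;s}(x)^2,$$ where $$\theta=\frac{(C_{n+s}^k)^2-C_{n+s}^{k-1}C_{n+s}^{k+1}}{(C_{n+s}^k)^2}$$ is a positive constant.
   Context: For $x=(x_1,\dots,x_n)\in\mathbb{R}^n$, $\sigma_k(x)=\sum_{1\le i_1<\cdots<i_k\le n}x_{i_1}\cdots x_{i_k}$ for $1\le k\le n$ is the $k$-th elementary symmetric function, with $\sigma_0(x)=1$ and $\sigma_k(x)=0$ for $k<0$ or $k>n$. $C_m^k=\frac{m!}{k!(m-k)!}$ is the binomial coefficient. For $\alpha=(\alpha_1,\dots,\alpha_s)\in\mathbb{R}^s$, define $$Q_{k;s}(x)=\sigma_k(x)+\sum_{i=1}^s\alpha_i\sigma_{k-i}(x),$$ a definition that is used for all integers $k\ge 0$ (including $k\le s$ and $k>n$) with the convention that $\sigma_0(x)=1$ and $\sigma_j(x)=0$ for $j<0$ or $j>n$. *)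

theory Defs
  imports Complex_Main "HOL-Computational_Algebra.Polynomial"
begin

text \<open>
  A vector in \<open>\<real>\<^sup>n\<close> is a function \<open>nat \<Rightarrow> real\<close> of which only the values at \<open>1, \<dots>, n\<close> are used;
  likewise for \<open>\<alpha> \<in> \<real>\<^sup>s\<close>. The degree of \<open>\<sigma>\<close> is an integer, because \<open>\<sigma>\<^bsub>k-i\<^esub>\<close> is needed with \<open>k < i\<close>.
  A choice of indices \<open>i\<^sub>1 < \<dots> < i\<^sub>k\<close> is the subset of \<open>{1..n}\<close> that they form.
\<close>

definition sigma :: "nat \<Rightarrow> (nat \<Rightarrow> real) \<Rightarrow> int \<Rightarrow> real" where
  "sigma n x k =
     (if k < 0 then 0 else (\<Sum>S | S \<subseteq> {1..n} \<and> card S = nat k. \<Prod>i\<in>S. x i))"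

lemma sigma_neg: "k < 0 \<Longrightarrow> sigma n x k = 0"
  by (simp add: sigma_def)

lemma sigma_0: "sigma n x 0 = 1"
proof -
  have "card S = 0 \<longleftrightarrow> S = {}" if "S \<subseteq> {1..n}" for S
    using card_0_eq[OF finite_subset[OF that finite_atLeastAtMost]] .
  then have "S \<subseteq> {1..n} \<and> card S = nat 0 \<longleftrightarrow> S = {}" for S
    by (metis card.empty empty_subsetI nat_0)
  then show ?thesis
    unfolding sigma_def by (simp only:) simp
qed

lemma sigma_gt:
  assumes "k > int n"
  shows "sigma n x k = 0"
proof -
  have "card S \<noteq> nat k" if "S \<subseteq> {1..n}" for S
  proof -
    have "card S \<le> n"
      using card_mono[OF finite_atLeastAtMost that] by simp
    with assms show ?thesis by linarith
  qed
  then have "{S. S \<subseteq> {1..n} \<and> card S = nat k} = {}"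
    by blast
  then show ?thesis unfolding sigma_def by (simp only: sum.empty if_cancel)
qed

definition Q :: "nat \<Rightarrow> nat \<Rightarrow> (nat \<Rightarrow> real) \<Rightarrow> (nat \<Rightarrow> real) \<Rightarrow> nat \<Rightarrow> real" where
  "Q n s \<alpha> x k = sigma n x (int k) + (\<Sum>i=1..s. \<alpha> i * sigma n x (int k - int i))"

definition f_poly :: "nat \<Rightarrow> (nat \<Rightarrow> real) \<Rightarrow> real poly" where
  "f_poly s \<alpha> = monom 1 s + (\<Sum>i=1..s. monom (\<alpha> i) (s - i))"

definition only_real_roots :: "real poly \<Rightarrow> bool" where
  "only_real_roots p \<longleftrightarrow> (\<forall>z::complex. poly (map_poly complex_of_real p) z = 0 \<longrightarrow> z \<in> \<real>)"

definition theta :: "nat \<Rightarrow> nat \<Rightarrow> nat \<Rightarrow> real" where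
  "theta n s k =
     ((real ((n + s) choose k))\<^sup>2
        - real ((n + s) choose (k - 1)) * real ((n + s) choose (k + 1)))
     / (real ((n + s) choose k))\<^sup>2"

end

theory Submission
  imports Defs "HOL-Computational_Algebra.Fundamental_Theorem_Algebra"
begin

text \<open>
  The numbers \<open>Q\<^sub>k\<close> are the coefficients of a single real-rooted polynomial. Since
  \<open>(t + x\<^sub>1) \<cdots> (t + x\<^sub>n)\<close> has the coefficients \<open>\<sigma>\<^sub>0, \<dots>, \<sigma>\<^sub>n\<close> in descending order, multiplying it
  by \<open>f\<close> convolves them with \<open>1, \<alpha>\<^sub>1, \<dots>, \<alpha>\<^sub>s\<close>, so that \<open>Q\<^sub>k\<close> is the coefficient of
  \<open>t\<^bsup>n+s-k\<^esup>\<close> in \<open>F(t) = f(t) (t + x\<^sub>1) \<cdots> (t + x\<^sub>n)\<close>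
  (\<open>coeff_f_poly_times_prod_linear\<close>). All roots of \<open>F\<close> are real and its degree is \<open>n + s\<close>; the
  claim is Newton's inequality for \<open>F\<close>, with the binomial coefficients moved into \<open>\<theta>\<close>.

  Newton's inequality (\<open>newton_inequality\<close>) comes from the quadratic case. Differentiation
  removes the low coefficients, and reversal of the coefficient sequence followed by differentiation
  removes the high ones; both operations keep all roots real. What is left is a quadratic
  whose coefficients are three consecutive coefficients of \<open>F\<close> up to factorials, and its
  discriminant is nonnegative.

  That differentiation keeps the roots real is a case of the Gauss--Lucas theorem: if \<open>p\<close> is
  not constant and all its roots \<open>r\<close> are real, then \<open>p'/p = \<Sum> 1/(z - r)\<close>, and for nonreal \<open>z\<close> every summand has an
  imaginary part of sign opposite to that of \<open>z\<close>, so \<open>p'(z) \<noteq> 0\<close> (\<open>Im_log_deriv_neg\<close>). Compared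
  with an argument by Rolle's theorem, this needs no count of multiplicities.
\<close>

section \<open>Complexification of real polynomials\<close>

abbreviation cpoly :: "real poly \<Rightarrow> complex poly" where
  "cpoly \<equiv> map_poly complex_of_real"

lemma coeff_cpoly: "coeff (cpoly p) i = complex_of_real (coeff p i)"
  by (simp add: coeff_map_poly)

lemma degree_cpoly: "degree (cpoly p) = degree p"
  by (rule degree_map_poly) simp

lemma cpoly_eq_0_iff: "cpoly p = 0 \<longleftrightarrow> p = 0"
  by (simp add: map_poly_eq_0_iff)

lemma cpoly_mult: "cpoly (p * q) = cpoly p * cpoly q"
  by (rule poly_eqI) (simp add: coeff_cpoly coeff_mult)

lemma cpoly_pderiv: "cpoly (pderiv p) = pderiv (cpoly p)"
  by (rule poly_eqI) (simp add: coeff_cpoly coeff_pderiv)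

lemma cpoly_reflect: "cpoly (reflect_poly p) = reflect_poly (cpoly p)"
  by (rule poly_eqI) (simp add: coeff_cpoly coeff_reflect_poly degree_cpoly)

section \<open>Operations that preserve real-rootedness\<close>

lemma only_real_roots_nonzero: "only_real_roots p \<Longrightarrow> p \<noteq> 0"
  unfolding only_real_roots_def by (auto simp: complex_is_Real_iff dest: spec[of _ "\<i>"])

lemma only_real_roots_mult:
  assumes "only_real_roots p" and "only_real_roots q"
  shows "only_real_roots (p * q)"
  using assms by (auto simp: only_real_roots_def cpoly_mult)

lemma only_real_roots_linear: "only_real_roots [:a, 1:]"
proof -
  have "z \<in> \<real>" if "complex_of_real a + z = 0" for z
    using that by (simp add: add_eq_0_iff)
  then show ?thesis
    by (auto simp: only_real_roots_def map_poly_pCons)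
qed

lemma only_real_roots_prod_linear: "only_real_roots (\<Prod>i\<in>A. [:x i, 1:])"
proof (induction A rule: infinite_finite_induct)
  case (insert i A)
  then show ?case
    by (simp only: prod.insert not_False_eq_True only_real_roots_mult only_real_roots_linear)
qed (simp_all add: only_real_roots_def)

text \<open>
  Splitting off one root \<open>r\<close> at a time, each contributes \<open>1/(z - r)\<close> to the logarithmic
  derivative, whose imaginary part is \<open>- Im z / |z - r|\<^sup>2\<close> because \<open>r\<close> is real. The factor
  \<open>Im z\<close> treats both half-planes at once.
\<close>
lemma Im_log_deriv_neg:
  fixes p :: "complex poly"
  assumes "p \<noteq> 0" and "degree p \<noteq> 0" and "\<And>w. poly p w = 0 \<Longrightarrow> w \<in> \<real>" and "z \<notin> \<real>"
  shows "Im z * Im (poly (pderiv p) z / poly p z) < 0"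
  using assms(1-3)
proof (induction "degree p" arbitrary: p rule: less_induct)
  case less
  obtain r where r: "poly p r = 0"
    using alg_closed_imp_poly_has_root less.prems(2) by blast
  then obtain q where p: "p = [:- r, 1:] * q"
    using poly_eq_0_iff_dvd by (metis dvdE)
  have q0: "q \<noteq> 0" using less.prems(1) p by auto
  have deg: "degree p = Suc (degree q)"
    unfolding p using q0 by (subst degree_mult_eq) auto
  have "r \<in> \<real>" using r less.prems(3) by blast
  then have Imr: "Im r = 0" by (simp add: complex_is_Real_iff)
  have Imz: "Im z \<noteq> 0" using assms(4) by (simp add: complex_is_Real_iff)
  have zr: "z - r \<noteq> 0" using Imr Imz by auto
  have qroots: "w \<in> \<real>" if "poly q w = 0" for w
    using that less.prems(3)[of w] by (simp add: p)
  then have qz: "poly q z \<noteq> 0" using assms(4) by blast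
  have split: "poly (pderiv p) z / poly p z = 1 / (z - r) + poly (pderiv q) z / poly q z"
    unfolding p pderiv_mult using zr qz
    by (simp add: pderiv_pCons field_simps)
  have first: "Im z * Im (1 / (z - r)) < 0"
  proof -
    have "(Re z - Re r)\<^sup>2 + (Im z)\<^sup>2 > 0" using Imz by (simp add: sum_power2_gt_zero_iff)
    then show ?thesis using Imz Imr
      by (simp add: Im_divide cmod_power2 divide_neg_pos flip: power2_eq_square)
  qed
  have second: "Im z * Im (poly (pderiv q) z / poly q z) \<le> 0"
  proof (cases "degree q = 0")
    case True
    then have "pderiv q = 0" by (simp add: pderiv_eq_0_iff)
    then show ?thesis by simp
  next
    case False
    then show ?thesis using less.hyps[of q] deg q0 qroots by fastforce
  qed
  show ?case unfolding split using first second by (simp add: distrib_left)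
qed

lemma only_real_roots_pderiv:
  assumes "only_real_roots p" and "pderiv p \<noteq> 0"
  shows "only_real_roots (pderiv p)"
proof -
  have "z \<in> \<real>" if "poly (pderiv (cpoly p)) z = 0" for z
  proof (rule ccontr)
    assume "z \<notin> \<real>"
    then have "Im z * Im (poly (pderiv (cpoly p)) z / poly (cpoly p) z) < 0"
      using assms only_real_roots_nonzero[OF assms(1)]
      by (intro Im_log_deriv_neg)
        (auto simp: only_real_roots_def cpoly_eq_0_iff degree_cpoly pderiv_eq_0_iff)
    with that show False by simp
  qed
  then show ?thesis by (simp add: only_real_roots_def cpoly_pderiv)
qed

lemma only_real_roots_higher_pderiv:
  assumes "only_real_roots p" and "(pderiv ^^ m) p \<noteq> 0"
  shows "only_real_roots ((pderiv ^^ m) p)"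
  using assms(2)
proof (induction m)
  case (Suc m)
  then have "(pderiv ^^ m) p \<noteq> 0" by auto
  with Suc show ?case by (simp add: only_real_roots_pderiv)
qed (simp add: assms(1))

text \<open>
  The nonzero roots of the reversed polynomial are the inverses of the nonzero roots of \<open>p\<close>.
\<close>
lemma only_real_roots_reflect:
  assumes "only_real_roots p"
  shows "only_real_roots (reflect_poly p)"
proof -
  have "z \<in> \<real>" if "poly (reflect_poly (cpoly p)) z = 0" for z
  proof (cases "z = 0")
    case False
    then have "poly (cpoly p) (inverse z) = 0"
      using that by (simp add: poly_reflect_poly_nz)
    then have "inverse z \<in> \<real>"
      using assms unfolding only_real_roots_def by blast
    then show ?thesis by simp
  qed simp
  then show ?thesis by (simp add: only_real_roots_def cpoly_reflect)
qed

section \<open>Newton's inequalities\<close>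

text \<open>
  A negative discriminant forces \<open>a \<noteq> 0\<close> and so yields the nonreal root
  \<open>(- b + \<i> \<surd>(4 a c - b\<^sup>2)) / (2 a)\<close>. The degree is only bounded because reversing the
  coefficients of a polynomial with the root \<open>0\<close> lowers its degree.
\<close>
lemma only_real_roots_discriminant:
  assumes "only_real_roots p" and "degree p \<le> 2"
  shows "4 * coeff p 0 * coeff p 2 \<le> (coeff p 1)\<^sup>2"
proof (rule ccontr)
  define a b c where "a = coeff p 2" and "b = coeff p 1" and "c = coeff p 0"
  assume "\<not> ?thesis"
  then have disc: "b\<^sup>2 < 4 * c * a" by (simp add: a_def b_def c_def)
  then have a0: "a \<noteq> 0" by auto
  have p: "p = [:c, b, a:]"
  proof (rule poly_eqI)
    fix i
    have "i = 0 \<or> i = 1 \<or> i = 2 \<or> degree p < i" using assms(2) by linarith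
    then show "coeff p i = coeff [:c, b, a:] i"
      by (auto simp: a_def b_def c_def coeff_eq_0 coeff_pCons numeral_2_eq_2 split: nat.split)
  qed
  define e where "e = sqrt (4 * c * a - b\<^sup>2)"
  have e2: "e\<^sup>2 = 4 * c * a - b\<^sup>2" and e0: "e \<noteq> 0" using disc by (auto simp: e_def)
  define z where "z = Complex (- b / (2 * a)) (e / (2 * a))"
  have "poly (cpoly p) z = 0"
    using a0 e2 by (simp add: p map_poly_pCons complex_eq_iff z_def field_simps power2_eq_square) algebra
  then have "z \<in> \<real>" using assms(1) by (simp add: only_real_roots_def)
  then show False using e0 a0 by (simp add: complex_is_Real_iff z_def)
qed

text \<open>
  The \<open>a\<close>-th derivative drops the coefficients below \<open>a\<close>; the \<open>b\<close>-th derivative of its reversal drops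
  those above \<open>a + 2\<close>. The weight of the coefficient \<open>i\<close> in \<open>w\<close> is
  what both rounds of differentiation multiply it by, up to the factor \<open>1/2\<close> in the two outer
  coefficients, which turns the discriminant condition \<open>4 d\<^sub>0 d\<^sub>2 \<le> d\<^sub>1\<^sup>2\<close> into log-concavity.
\<close>
lemma weighted_coeffs_log_concave:
  fixes p :: "real poly"
  assumes "only_real_roots p" and deg: "degree p = a + b + 2"
  defines "w \<equiv> \<lambda>i. fact i * fact (degree p - i) * coeff p i"
  shows "w a * w (a + 2) \<le> (w (a + 1))\<^sup>2"
proof -
  have poch: "pochhammer (of_nat (Suc i)) m = (fact (i + m) / fact i :: real)" for i m
  proof -
    have "(fact (i + m) :: real) = fact i * pochhammer (of_nat (Suc i)) m"
      by (simp add: pochhammer_fact pochhammer_product')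
    then show ?thesis by simp
  qed
  define q where "q = (pderiv ^^ a) p"
  have degq: "degree q = b + 2" unfolding q_def degree_higher_pderiv deg by simp
  then have q0: "q \<noteq> 0" by auto
  have q: "only_real_roots q"
    using only_real_roots_higher_pderiv[OF assms(1)] q0 by (simp add: q_def)
  have coeffq: "coeff q i = fact (i + a) / fact i * coeff p (i + a)" for i
    unfolding q_def coeff_higher_pderiv poch ..
  define d where "d = (pderiv ^^ b) (reflect_poly q)"
  have coeffd: "coeff d i = fact (i + b) / fact i * coeff q (2 - i)" if "i \<le> 2" for i
    using that unfolding d_def coeff_higher_pderiv poch by (simp add: coeff_reflect_poly degq)
  have d0: "coeff d 0 = w (a + 2) / 2"
    by (simp add: coeffd coeffq w_def deg fact_numeral)
  have d1: "coeff d 1 = w (a + 1)"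
    by (simp add: coeffd coeffq w_def deg add.commute)
  have d2: "coeff d 2 = w a / 2"
    by (simp add: coeffd coeffq w_def deg fact_numeral add.commute)
  \<comment> \<open>The polynomial \<open>d\<close> vanishes when the coefficients \<open>a\<close>, \<open>a + 1\<close>, \<open>a + 2\<close> of \<open>p\<close> are all
    zero; the zero polynomial does not count as real-rooted.\<close>
  have "4 * coeff d 0 * coeff d 2 \<le> (coeff d 1)\<^sup>2"
  proof (cases "d = 0")
    case False
    have "degree d \<le> 2"
      using degree_reflect_poly_le[of q] degq by (simp add: d_def degree_higher_pderiv)
    moreover have "only_real_roots d"
      using only_real_roots_higher_pderiv[OF only_real_roots_reflect[OF q]] False
      by (simp add: d_def)
    ultimately show ?thesis by (rule only_real_roots_discriminant[rotated])
  qed simp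
  then show ?thesis unfolding d0 d1 d2 by (simp add: mult.commute)
qed

theorem newton_inequality:
  fixes p :: "real poly"
  assumes "only_real_roots p" and "degree p = n" and "0 < j" and "j < n"
  shows "coeff p (j - 1) / (n choose (j - 1)) * (coeff p (j + 1) / (n choose (j + 1)))
           \<le> (coeff p j / (n choose j))\<^sup>2"
proof -
  \<comment> \<open>Dividing by the binomial coefficient is the factorial weighting, up to the
    common factor \<open>n!\<close>.\<close>
  define w where "w i = fact i * fact (n - i) * coeff p i" for i
  have w: "coeff p i / (n choose i) = w i / fact n" if "i \<le> n" for i
    using that by (simp add: w_def binomial_fact)
  obtain a where a: "j = a + 1" using assms(3) by (metis Suc_eq_plus1 gr0_implies_Suc)
  obtain b where "n = j + b + 1" using assms(4) less_imp_Suc_add by fastforce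
  then have b: "degree p = a + b + 2" using a assms(2) by simp
  have "w a * w (a + 2) \<le> (w (a + 1))\<^sup>2"
    using weighted_coeffs_log_concave[OF assms(1) b] unfolding w_def assms(2) .
  then have "w a / fact n * (w (a + 2) / fact n) \<le> (w (a + 1) / fact n)\<^sup>2"
    by (simp add: power2_eq_square divide_right_mono)
  then show ?thesis
    using assms(4) by (simp add: a w)
qed

section \<open>Elementary symmetric functions and the numbers \<open>Q\<close> as coefficients\<close>

lemma prod_linear_expansion:
  fixes x :: "'i \<Rightarrow> 'a :: comm_semiring_1"
  assumes "finite A"
  shows "(\<Prod>i\<in>A. [:x i, 1:]) = (\<Sum>S\<in>Pow A. monom (\<Prod>i\<in>S. x i) (card A - card S))"
proof -
  have "(\<Prod>i\<in>A. [:x i, 1:]) = (\<Prod>i\<in>A. [:x i:] + monom 1 1)"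
    by (simp add: monom_altdef)
  also have "\<dots> = (\<Sum>S\<in>Pow A. (\<Prod>i\<in>S. [:x i:]) * (\<Prod>i\<in>A - S. monom 1 1))"
    by (rule prod_add[OF assms])
  also have "\<dots> = (\<Sum>S\<in>Pow A. monom (\<Prod>i\<in>S. x i) (card A - card S))"
  proof (intro sum.cong refl)
    fix S assume "S \<in> Pow A"
    then have "card (A - S) = card A - card S"
      using assms by (auto intro: card_Diff_subset finite_subset)
    moreover have "(\<Prod>i\<in>S. [:x i:]) = [:\<Prod>i\<in>S. x i:]"
    proof (induction S rule: infinite_finite_induct)
      case (insert i S)
      then show ?case by (simp add: mult.commute)
    qed (simp_all add: one_pCons)
    ultimately show "(\<Prod>i\<in>S. [:x i:]) * (\<Prod>i\<in>A - S. monom 1 1) = monom (\<Prod>i\<in>S. x i) (card A - card S)"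
      by (simp add: monom_power smult_monom)
  qed
  finally show ?thesis .
qed

text \<open>
  For \<open>m > n\<close> both sides vanish: the integer degree of \<open>\<sigma>\<close> is then negative.
\<close>
lemma coeff_prod_linear: "coeff (\<Prod>i\<in>{1..n}. [:x i, 1:]) m = sigma n x (int n - int m)"
proof -
  have "coeff (\<Prod>i\<in>{1..n}. [:x i, 1:]) m
      = (\<Sum>S\<in>Pow {1..n}. if n - card S = m then \<Prod>i\<in>S. x i else 0)"
    by (simp add: prod_linear_expansion coeff_sum)
  also have "\<dots> = (\<Sum>S | S \<subseteq> {1..n} \<and> n - card S = m. \<Prod>i\<in>S. x i)"
    by (subst sum.inter_filter[symmetric]) (auto intro!: sum.cong)
  also have "\<dots> = sigma n x (int n - int m)"
  proof (cases "m \<le> n")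
    case True
    have "card S \<le> n" if "S \<subseteq> {1..n}" for S
      using card_mono[OF _ that] by simp
    then have "S \<subseteq> {1..n} \<and> n - card S = m \<longleftrightarrow> S \<subseteq> {1..n} \<and> card S = nat (int n - int m)" for S
      using True by (smt (verit) diff_diff_cancel nat_int of_nat_diff)
    then show ?thesis using True by (simp add: sigma_def)
  next
    case False
    then have empty: "{S. S \<subseteq> {1..n} \<and> n - card S = m} = {}" by auto
    show ?thesis unfolding empty using False by (simp add: sigma_neg)
  qed
  finally show ?thesis .
qed

text \<open>
  The term \<open>\<alpha>\<^sub>i t\<^bsup>s-i\<^esup>\<close> of \<open>f\<close> shifts \<open>\<sigma>\<^bsub>k-i\<^esub>\<close> from the exponent \<open>n - (k - i)\<close> to \<open>n + s - k\<close>.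
  The conventions \<open>\<sigma>\<^sub>j = 0\<close> for \<open>j < 0\<close> and \<open>j > n\<close> account for the exponents that do not occur
  in the product of the linear factors.
\<close>
lemma coeff_f_poly_times_prod_linear:
  assumes "k \<le> n + s"
  shows "coeff (f_poly s \<alpha> * (\<Prod>i\<in>{1..n}. [:x i, 1:])) (n + s - k) = Q n s \<alpha> x k"
proof -
  let ?P = "\<Prod>i\<in>{1..n}. [:x i, 1:]"
  have coeff_summand: "coeff (monom c (s - i) * ?P) (n + s - k) = c * sigma n x (int k - int i)"
    if "i \<le> s" for c i
  proof (cases "n + s - k < s - i")
    case True
    then show ?thesis by (simp add: coeff_monom_mult sigma_gt)
  next
    case False
    then have "int n - int (n + s - k - (s - i)) = int k - int i"
      using assms that by linarith
    then show ?thesis using False by (simp only: coeff_monom_mult coeff_prod_linear if_False)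
  qed
  have "coeff (f_poly s \<alpha> * ?P) (n + s - k)
      = coeff (monom 1 (s - 0) * ?P) (n + s - k)
        + (\<Sum>i=1..s. coeff (monom (\<alpha> i) (s - i) * ?P) (n + s - k))"
    unfolding f_poly_def distrib_right sum_distrib_right coeff_add coeff_sum by simp
  also have "\<dots> = 1 * sigma n x (int k - int 0)
      + (\<Sum>i=1..s. \<alpha> i * sigma n x (int k - int i))"
    by (intro arg_cong2[where f = plus] sum.cong refl coeff_summand) auto
  finally show ?thesis by (simp add: Q_def)
qed

lemma degree_f_poly: "degree (f_poly s \<alpha>) = s"
proof (rule antisym)
  have "coeff (f_poly s \<alpha>) s = 1"
    by (auto simp: f_poly_def coeff_sum intro!: sum.neutral)
  then show "s \<le> degree (f_poly s \<alpha>)" by (simp add: le_degree)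
  show "degree (f_poly s \<alpha>) \<le> s"
    unfolding f_poly_def
    by (intro degree_add_le degree_sum_le) (auto intro: order.trans[OF degree_monom_le])
qed

lemma degree_prod_linear: "finite A \<Longrightarrow> degree (\<Prod>i\<in>A. [:x i, 1 :: real:]) = card A"
  by (subst degree_prod_eq_sum_degree) auto

section \<open>Strict log-concavity of the binomial coefficients\<close>

lemma binomial_absorb_step: "Suc k * (n choose Suc k) = (n - k) * (n choose k)"
  by (metis binomial_absorb_comp binomial_absorption)

text \<open>
  By the ratios of neighbouring binomial coefficients, the left side is the right side times
  \<open>(a + 1)/(a + 2) \<cdot> (b + 1)/(b + 2) < 1\<close>.
\<close>
lemma binomial_strict_log_concave:
  assumes n: "n = a + b + 2"
  shows "real (n choose a) * real (n choose (a + 2)) < (real (n choose (a + 1)))\<^sup>2"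
proof -
  let ?C = "real (n choose (a + 1))"
  have C: "?C > 0" by (simp only: of_nat_0_less_iff zero_less_binomial_iff n)
  have "(a + 2) * (n choose (a + 2)) = (b + 1) * (n choose (a + 1))"
    and "(a + 1) * (n choose (a + 1)) = (b + 2) * (n choose a)"
    using binomial_absorb_step[of "a + 1" n] binomial_absorb_step[of a n] by (simp_all add: n)
  then have "real (a + 2) * real (n choose (a + 2)) = real (b + 1) * ?C"
    and "real (a + 1) * ?C = real (b + 2) * real (n choose a)"
    by (metis of_nat_mult)+
  then have "real (n choose (a + 2)) = real (b + 1) / real (a + 2) * ?C"
    and "real (n choose a) = real (a + 1) / real (b + 2) * ?C"
    by (simp_all add: eq_divide_eq mult.commute)
  then have "real (n choose a) * real (n choose (a + 2))
      = ?C\<^sup>2 * (real (a + 1) / real (b + 2) * (real (b + 1) / real (a + 2)))"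
    by (simp only: power2_eq_square mult_ac)
  also have "\<dots> < ?C\<^sup>2 * 1"
  proof (rule mult_strict_left_mono)
    show "real (a + 1) / real (b + 2) * (real (b + 1) / real (a + 2)) < 1"
      unfolding times_divide_times_eq
      by (subst divide_less_eq_1_pos) (rule mult_pos_pos, simp_all add: algebra_simps)
  qed (use C in simp)
  finally show ?thesis by simp
qed

section \<open>Newton's inequality for the numbers \<open>Q\<close>\<close>

theorem theorem7:
  fixes n s k :: nat and x \<alpha> :: "nat \<Rightarrow> real"
  assumes "1 \<le> s" and "s + 1 < n"
    and "only_real_roots (f_poly s \<alpha>)"
    and "1 \<le> k" and "k \<le> n"
  shows "(Q n s \<alpha> x k)\<^sup>2 - Q n s \<alpha> x (k - 1) * Q n s \<alpha> x (k + 1)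
           \<ge> theta n s k * (Q n s \<alpha> x k)\<^sup>2
         \<and> theta n s k > 0"
proof -
  define F where "F = f_poly s \<alpha> * (\<Prod>i\<in>{1..n}. [:x i, 1:])"
  define N where "N = n + s"
  have k: "0 < k" "k < N" using assms by (auto simp: N_def)
  have F: "only_real_roots F"
    unfolding F_def by (intro only_real_roots_mult assms only_real_roots_prod_linear)
  have "f_poly s \<alpha> \<noteq> 0" by (rule only_real_roots_nonzero[OF assms(3)])
  then have degF: "degree F = N"
    unfolding F_def N_def by (subst degree_mult_eq) (auto simp: degree_f_poly degree_prod_linear)
  have coeffF: "coeff F (N - i) = Q n s \<alpha> x i" if "i \<le> N" for i
    using coeff_f_poly_times_prod_linear that by (simp add: F_def N_def)
  \<comment> \<open>\<open>Q\<^sub>k\<close> sits at the exponent \<open>N - k\<close>, so its neighbours change places.\<close>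
  have ind: "N - k - 1 = N - (k + 1)" "N - k + 1 = N - (k - 1)" using k by auto
  have le: "k - 1 \<le> N" "k \<le> N" "k + 1 \<le> N" using k by auto
  define A B C where "A = real (N choose (k - 1))" and "B = real (N choose k)"
    and "C = real (N choose (k + 1))"
  have pos: "A > 0" "B > 0" "C > 0" using k by (auto simp: A_def B_def C_def)
  have sym: "real (N choose (N - i)) = real (N choose i)" if "i \<le> N" for i
    using that by (simp add: binomial_symmetric[symmetric])
  have "Q n s \<alpha> x (k + 1) / C * (Q n s \<alpha> x (k - 1) / A) \<le> (Q n s \<alpha> x k / B)\<^sup>2"
    using newton_inequality[OF F degF, of "N - k", unfolded ind] k
    by (simp only: zero_less_diff diff_less A_def B_def C_def le sym coeffF)
  then have "Q n s \<alpha> x (k - 1) * Q n s \<alpha> x (k + 1) \<le> A * C / B\<^sup>2 * (Q n s \<alpha> x k)\<^sup>2"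
    using pos by (simp add: power_divide field_simps)
  moreover have theta: "theta n s k = 1 - A * C / B\<^sup>2"
    using pos by (simp add: theta_def A_def B_def C_def N_def field_simps)
  moreover have "A * C < B\<^sup>2"
    using binomial_strict_log_concave[of N "k - 1" "N - k - 1"] k
    by (simp add: A_def B_def C_def)
  then have "A * C / B\<^sup>2 < 1" using pos by simp
  ultimately show ?thesis unfolding theta left_diff_distrib by simp
qed

end
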